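(* Let $N\ge 1$, let $\Gamma_1,\dots,\Gamma_N\in\mathbb{R}$, and for $z_\alpha=x_\alpha+iy_\alpha\in\mathbb{C}$ with $z_\alpha-z_\beta\notin 2\pi\mathbb{Z}+i\pi\mathbb{Z}$ and $z_\alpha-\bar z_\beta\notin \pi+2\pi\mathbb{Z}+i\pi\mathbb{Z}$ for all $\alpha\ne\beta$, define $$\mathcal{H}= -\frac{1}{2\pi}\sum_{\alpha<\beta}\Gamma_{\alpha}\Gamma_{\beta}\log\left|\theta_1\left(\frac{z_{\alpha}-z_{\beta}}{2},e^{-\frac{\pi}{2}}\right)\right| + \frac{1}{2\pi}\sum_{\alpha<\beta}\Gamma_{\alpha}\Gamma_{\beta}\log\left|\theta_2\left(\frac{z_{\alpha}-\bar{z}_{\beta}}{2},e^{-\frac{\pi}{2}}\right)\right| -\frac{1}{\pi^2}\sum_{\alpha<\beta}\Gamma_{\alpha}\Gamma_{\beta}y_{\alpha}y_{\beta} + \frac{1}{4\pi}\sum_{\alpha}\Gamma_{\alpha}^2\left(\log\left|\theta_1\left(iy_{\alpha} - \frac{\pi}{2},e^{-\frac{\pi}{2}}\right)\right| - \frac{2y_{\alpha}^2}{\pi}\right).$$ Then, for each index $j\in\{1,\dots,N\}$, $\mathcal{H}$ is (i) $\pi$-periodic vertically: it is unchanged under $z_j\mapsto z_j+i\pi$ (all other positions and all strengths fixed); (ii) $2\pi$-periodic horizontally: it is unchanged under $z_j\mapsto z_j+2\pi$ (all other positions and all strengths fixed); (iii) invariant under $\mu$: it is unchanged under the simultaneous replacement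 $z_j\mapsto\mu(z_j)=\bar z_j+\pi$, $\Gamma_j\mapsto-\Gamma_j$ (all other positions and strengths fixed).
   Context: $\theta_1,\theta_2$ are the Jacobi theta functions, given for $z\in\mathbb{C}$ and real $0<q<1$ by $\theta_1(z,q)=2\sum_{n=0}^{\infty}(-1)^n q^{(n+1/2)^2}\sin((2n+1)z)$ and $\theta_2(z,q)=2\sum_{n=0}^{\infty} q^{(n+1/2)^2}\cos((2n+1)z)$. $\mathcal{H}$ is the Hamiltonian of $N$ point vortices with strengths $\Gamma_\alpha$ at $z_\alpha$ on the Klein bottle, viewed as the quotient of the torus $\mathbb{C}/(2\pi\mathbb{Z}+i\pi\mathbb{Z})$ by the orientation-reversing involution $\mu(z)=\bar z+\pi$. Vortex strengths are twisted scalars: applying $\mu$ to a vortex changes the sign of its strength. *)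

theory Defs
  imports Complex_Main
begin

definition theta1 :: "complex \<Rightarrow> real \<Rightarrow> complex" where
  "theta1 z q = 2 * (\<Sum>n. (-1) ^ n * complex_of_real (q powr ((real n + 1/2)\<^sup>2))
                          * sin (of_nat (2 * n + 1) * z))"

definition theta2 :: "complex \<Rightarrow> real \<Rightarrow> complex" where
  "theta2 z q = 2 * (\<Sum>n. complex_of_real (q powr ((real n + 1/2)\<^sup>2))
                          * cos (of_nat (2 * n + 1) * z))"

definition torus_lattice :: "complex set" where
  "torus_lattice = {2 * of_real pi * of_int m + \<i> * of_real pi * of_int n | m n. True}"

text \<open>The orientation-reversing involution whose quotient of the torus is the Klein bottle.\<close>

definition klein_mu :: "complex \<Rightarrow> complex" where
  "klein_mu z = cnj z + of_real pi"

text \<open>Vortices are indexed by \<open>1, \<dots>, N\<close>; the values of \<open>\<Gamma>\<close> and \<open>z\<close>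
  at other indices are irrelevant. No two vortices coincide on the Klein bottle, i.e.
  \<open>z a\<close> is congruent neither to \<open>z b\<close> nor to its image under \<open>klein_mu\<close>.\<close>

definition vortex_config :: "nat \<Rightarrow> (nat \<Rightarrow> complex) \<Rightarrow> bool" where
  "vortex_config N z \<longleftrightarrow>
     (\<forall>a\<in>{1..N}. \<forall>b\<in>{1..N}. a \<noteq> b \<longrightarrow>
        z a - z b \<notin> torus_lattice \<and>
        z a - cnj (z b) \<notin> (\<lambda>w. of_real pi + w) ` torus_lattice)"

definition klein_hamiltonian :: "nat \<Rightarrow> (nat \<Rightarrow> real) \<Rightarrow> (nat \<Rightarrow> complex) \<Rightarrow> real" where
  "klein_hamiltonian N \<Gamma> z =
     - (1 / (2 * pi)) * (\<Sum>a = 1..N. \<Sum>b\<in>{a<..N}.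
          \<Gamma> a * \<Gamma> b * ln (norm (theta1 ((z a - z b) / 2) (exp (- pi / 2)))))
     + (1 / (2 * pi)) * (\<Sum>a = 1..N. \<Sum>b\<in>{a<..N}.
          \<Gamma> a * \<Gamma> b * ln (norm (theta2 ((z a - cnj (z b)) / 2) (exp (- pi / 2)))))
     - (1 / pi\<^sup>2) * (\<Sum>a = 1..N. \<Sum>b\<in>{a<..N}. \<Gamma> a * \<Gamma> b * Im (z a) * Im (z b))
     + (1 / (4 * pi)) * (\<Sum>a = 1..N. (\<Gamma> a)\<^sup>2 *
          (ln (norm (theta1 (\<i> * of_real (Im (z a)) - of_real pi / 2) (exp (- pi / 2))))
           - 2 * (Im (z a))\<^sup>2 / pi))"

end

theory Submission
  imports Defs "HOL-Analysis.Complex_Transcendental"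
begin

text \<open>The Hamiltonian is a sum of a symmetric two-vortex energy and a self-energy, so only the
  terms containing vortex \<open>j\<close> have to be compared, and there the quasi-periodicity of the theta
  functions gives the claims. As \<open>ln 0 = 0\<close>, the vertical shift moreover requires
  that \<open>theta1\<close> has no zeros off its lattice. For a nome \<open>q \<le> 1/4\<close> this needs no
  product formula: in the strip \<open>\<bar>Im z\<bar> \<le> - ln q / 2\<close> the leading term \<open>2 q\<^sup>1\<^sup>/\<^sup>4 sin z\<close> dominates
  the sum of all the others, and quasi-periodicity moves every point into this strip.\<close>

section \<open>Theta functions\<close>

text \<open>One half of the bilateral exponential series of \<open>theta1\<close>: splitting each
  sine into exponentials gives these terms at z and at -z. The nome is q = e^(-t), so q^((n+1/2)^2)
  joins the exponent and index shifts become additions of exponents.\<close>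

definition theta_term :: "real \<Rightarrow> complex \<Rightarrow> nat \<Rightarrow> complex" where
  "theta_term t z n = (-1) ^ n * exp (of_real (- t * (real n + 1/2)\<^sup>2) + \<i> * of_nat (2 * n + 1) * z)"

lemma theta_term_Suc:
  "theta_term t z (Suc n) = - exp (of_real (- t * (2 * real n + 2)) + 2 * \<i> * z) * theta_term t z n"
proof -
  have "of_real (- t * (real (Suc n) + 1/2)\<^sup>2) + \<i> * of_nat (2 * Suc n + 1) * z
      = (of_real (- t * (2 * real n + 2)) + 2 * \<i> * z)
        + (of_real (- t * (real n + 1/2)\<^sup>2) + \<i> * of_nat (2 * n + 1) * z)"
    by (simp add: power2_eq_square field_simps)
  then show ?thesis
    unfolding theta_term_def by (simp only: exp_add power_Suc) (simp add: mult_ac)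
qed

lemma summable_theta_term:
  assumes "t > 0"
  shows "summable (theta_term t z)"
proof -
  \<comment> \<open>From index \<open>M\<close> on, the exponent in the modulus of the ratio of
    consecutive terms is at most -1, and e >= 2 turns this into the ratio 1/2.\<close>
  obtain M :: nat where M: "(\<bar>Im z\<bar> + 1) / t \<le> real M"
    using real_arch_simple by blast
  show ?thesis
  proof (rule summable_ratio_test)
    show "(1/2 :: real) < 1" by simp
    fix n assume "n \<ge> M"
    have "\<bar>Im z\<bar> + 1 \<le> t * real M"
      using M assms by (simp add: field_simps)
    also have "\<dots> \<le> t * (real n + 1)"
      using \<open>n \<ge> M\<close> assms by (intro mult_left_mono) auto
    finally have "- t * (2 * real n + 2) - 2 * Im z \<le> - 1"
      by (simp add: algebra_simps)
    then have "exp (- t * (2 * real n + 2) - 2 * Im z) \<le> exp (- 1)"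
      by simp
    also have "\<dots> \<le> 1 / 2"
      using exp_ge_add_one_self[of 1] by (simp add: exp_minus field_simps)
    finally have le: "exp (- t * (2 * real n + 2) - 2 * Im z) \<le> 1 / 2" .
    have "norm (theta_term t z (Suc n))
        = exp (- t * (2 * real n + 2) - 2 * Im z) * norm (theta_term t z n)"
      by (simp add: theta_term_Suc norm_mult)
    then show "norm (theta_term t z (Suc n)) \<le> 1 / 2 * norm (theta_term t z n)"
      using mult_right_mono[OF le norm_ge_zero] by simp
  qed
qed

lemma exp_neg_powr: "exp (- t) powr r = exp (- t * r)" for t r :: real
  by (simp add: powr_def mult.commute)

lemma theta1_term_eq:
  "(-1) ^ n * complex_of_real (exp (- t) powr ((real n + 1/2)\<^sup>2)) * sin (of_nat (2 * n + 1) * z)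
    = - \<i> / 2 * (theta_term t z n - theta_term t (- z) n)"
proof -
  have "- \<i> / 2 * (s * (g * u) - s * (g * v)) = s * g * (\<i> * (v - u) / 2)" for s g u v :: complex
    by (simp add: algebra_simps)
  then show ?thesis
    unfolding theta_term_def exp_neg_powr sin_exp_eq' exp_add exp_of_real mult.assoc mult_minus_right
    by (simp only: mult.assoc)
qed

lemma theta1_eq:
  assumes "t > 0"
  shows "theta1 z (exp (- t)) = - \<i> * (suminf (theta_term t z) - suminf (theta_term t (- z)))"
proof -
  have "(\<lambda>n. - \<i> / 2 * (theta_term t z n - theta_term t (- z) n)) sums
      (- \<i> / 2 * (suminf (theta_term t z) - suminf (theta_term t (- z))))"
    by (intro sums_mult sums_diff summable_sums summable_theta_term assms)
  then show ?thesis
    unfolding theta1_def theta1_term_eq by (simp add: sums_unique[symmetric])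
qed

lemma summable_theta1:
  assumes "t > 0"
  shows "summable (\<lambda>n. (-1) ^ n * complex_of_real (exp (- t) powr ((real n + 1/2)\<^sup>2))
                       * sin (of_nat (2 * n + 1) * z))"
  unfolding theta1_term_eq
  by (intro summable_mult summable_diff summable_theta_term assms)

lemma theta1_minus:
  assumes "t > 0"
  shows "theta1 (- z) (exp (- t)) = - theta1 z (exp (- t))"
  using assms by (simp add: theta1_eq algebra_simps)

text \<open>In terms of the bilateral series of \<open>theta1\<close>, the shift of \<open>z\<close> moves the index by one; the
  two halves of the series exchange the term of index \<open>0\<close>.\<close>

lemma theta1_add_period_tau:
  assumes "t > 0"
  shows "theta1 (z + \<i> * of_real t) (exp (- t)) = - exp (of_real t - 2 * \<i> * z) * theta1 z (exp (- t))"
proof -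
  define c where "c = exp (of_real t - 2 * \<i> * z)"
  let ?z' = "z + \<i> * of_real t"
  have up: "theta_term t ?z' n = - c * theta_term t z (Suc n)" for n
  proof -
    have "of_real (- t * (real n + 1/2)\<^sup>2) + \<i> * of_nat (2 * n + 1) * ?z'
        = (of_real t - 2 * \<i> * z)
          + (of_real (- t * (real (Suc n) + 1/2)\<^sup>2) + \<i> * of_nat (2 * Suc n + 1) * z)"
      by (simp add: power2_eq_square field_simps)
    then show ?thesis
      unfolding theta_term_def c_def by (simp only: exp_add power_Suc) (simp add: mult_ac)
  qed
  have down: "theta_term t (- ?z') (Suc n) = - c * theta_term t (- z) n" for n
  proof -
    have "of_real (- t * (real (Suc n) + 1/2)\<^sup>2) + \<i> * of_nat (2 * Suc n + 1) * - ?z'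
        = (of_real t - 2 * \<i> * z)
          + (of_real (- t * (real n + 1/2)\<^sup>2) + \<i> * of_nat (2 * n + 1) * - z)"
      by (simp add: power2_eq_square field_simps)
    then show ?thesis
      unfolding theta_term_def c_def by (simp only: exp_add power_Suc) (simp add: mult_ac)
  qed
  have head: "theta_term t (- ?z') 0 = c * theta_term t z 0"
    unfolding theta_term_def c_def
    by (simp add: power2_eq_square field_simps flip: exp_add)
  note summ = summable_theta_term[OF assms]
  have "suminf (theta_term t ?z') = - c * (suminf (theta_term t z) - theta_term t z 0)"
    unfolding up suminf_split_head[OF summ, symmetric]
    using summable_Suc_iff[THEN iffD2, OF summ] by (subst suminf_mult) auto
  moreover have "suminf (theta_term t (- ?z')) - c * theta_term t z 0 = - c * suminf (theta_term t (- z))"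
    using suminf_split_head[OF summ, of "- ?z'"]
    unfolding down head using suminf_mult[OF summ, of "- c" "- z"] by simp
  ultimately have "suminf (theta_term t ?z') - suminf (theta_term t (- ?z'))
      = - c * (suminf (theta_term t z) - suminf (theta_term t (- z)))"
    by algebra
  then show ?thesis
    unfolding theta1_eq[OF assms] c_def[symmetric] by simp
qed

section \<open>Half-period shifts, parity and conjugation\<close>

lemma sin_cos_odd_mult_plus_pi_half:
  fixes z :: complex
  shows "sin (of_nat (2 * n + 1) * (z + of_real pi / 2)) = (-1) ^ n * cos (of_nat (2 * n + 1) * z)"
    and "cos (of_nat (2 * n + 1) * (z + of_real pi / 2)) = - ((-1) ^ n * sin (of_nat (2 * n + 1) * z))"
proof -
  \<comment> \<open>The odd multiple of pi/2 is n pi + pi/2, where the cosine vanishes and the sine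
    is (-1)^n, so one term of each addition formula survives.\<close>
  have eq: "of_nat (2 * n + 1) * (z + of_real pi / 2)
      = of_nat (2 * n + 1) * z + of_real (real n * pi + pi / 2)"
    by (simp add: field_simps)
  have "cos (real n * pi + pi / 2) = 0" "sin (real n * pi + pi / 2) = (-1) ^ n"
    by (simp_all add: sin_add cos_add)
  then have cs: "cos (complex_of_real (real n * pi + pi / 2)) = 0"
      "sin (complex_of_real (real n * pi + pi / 2)) = (-1) ^ n"
    by (simp_all only: cos_of_real sin_of_real) simp_all
  show "sin (of_nat (2 * n + 1) * (z + of_real pi / 2)) = (-1) ^ n * cos (of_nat (2 * n + 1) * z)"
    "cos (of_nat (2 * n + 1) * (z + of_real pi / 2)) = - ((-1) ^ n * sin (of_nat (2 * n + 1) * z))"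
    unfolding eq sin_add cos_add cs by simp_all
qed

lemma minus_one_power_mult_cancel: "(-1) ^ n * a * ((-1) ^ n * b) = a * b"
  for a b :: "'a :: comm_ring_1"
  by (cases "even n") simp_all

lemma theta1_plus_pi_half: "theta1 (z + of_real pi / 2) q = theta2 z q"
  unfolding theta1_def theta2_def sin_cos_odd_mult_plus_pi_half minus_one_power_mult_cancel ..

text \<open>The two series agree termwise up to a sign; convergence allows the sign to be taken out
  of the sum.\<close>

lemma theta2_plus_pi_half:
  assumes "t > 0"
  shows "theta2 (z + of_real pi / 2) (exp (- t)) = - theta1 z (exp (- t))"
proof -
  have "theta2 (z + of_real pi / 2) (exp (- t))
      = 2 * (\<Sum>n. - ((-1) ^ n * complex_of_real (exp (- t) powr ((real n + 1/2)\<^sup>2))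
                       * sin (of_nat (2 * n + 1) * z)))"
    unfolding theta2_def sin_cos_odd_mult_plus_pi_half by (simp add: mult_ac)
  then show ?thesis
    unfolding theta1_def suminf_minus[OF summable_theta1[OF assms]] by simp
qed

lemma theta1_plus_pi:
  assumes "t > 0"
  shows "theta1 (z + of_real pi) (exp (- t)) = - theta1 z (exp (- t))"
  using theta1_plus_pi_half[of "z + of_real pi / 2" "exp (- t)"] theta2_plus_pi_half[OF assms, of z]
  by (simp add: add.assoc)

lemma theta2_plus_pi:
  assumes "t > 0"
  shows "theta2 (z + of_real pi) (exp (- t)) = - theta2 z (exp (- t))"
  using theta2_plus_pi_half[OF assms, of "z + of_real pi / 2"] theta1_plus_pi_half[of z "exp (- t)"]
  by (simp add: add.assoc)

lemma theta2_minus: "theta2 (- z) q = theta2 z q"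
  by (simp add: theta2_def)

text \<open>The coefficients are real, and conjugation is continuous, so it passes through the
  convergent sum.\<close>

lemma theta2_cnj:
  assumes "t > 0"
  shows "theta2 (cnj z) (exp (- t)) = cnj (theta2 z (exp (- t)))"
proof -
  have "summable (\<lambda>n. complex_of_real (exp (- t) powr ((real n + 1/2)\<^sup>2)) * cos (of_nat (2 * n + 1) * z))"
    using summable_theta1[OF assms, of "z + of_real pi / 2"]
    unfolding sin_cos_odd_mult_plus_pi_half minus_one_power_mult_cancel .
  then have "(\<lambda>n. cnj (complex_of_real (exp (- t) powr ((real n + 1/2)\<^sup>2)) * cos (of_nat (2 * n + 1) * z)))
      sums cnj (\<Sum>n. complex_of_real (exp (- t) powr ((real n + 1/2)\<^sup>2)) * cos (of_nat (2 * n + 1) * z))"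
    by (simp only: sums_cnj summable_sums)
  then show ?thesis
    unfolding theta2_def by (simp add: cnj_cos sums_unique[symmetric])
qed

lemma theta1_cnj:
  assumes "t > 0"
  shows "theta1 (cnj z) (exp (- t)) = cnj (theta1 z (exp (- t)))"
  using theta2_plus_pi_half[OF assms, of z] theta2_plus_pi_half[OF assms, of "cnj z"]
    theta2_cnj[OF assms, of "z + of_real pi / 2"] by simp

section \<open>Zeros of the first theta function\<close>

text \<open>Induction along sin((2n+3)z) = sin((2n+1)z) + 2 cos((2n+2)z) sin z, with the cosine at
  most e^(t(n+1)) in the strip. The factor |sin z| on the right keeps the bound useful near the
  zeros of the sine.\<close>

lemma norm_sin_odd_mult_le:
  fixes z :: complex
  assumes t: "exp t \<ge> 4" and z: "\<bar>Im z\<bar> \<le> t / 2"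
  shows "norm (sin (of_nat (2 * n + 1) * z)) \<le> 8 / 3 * exp t ^ n * norm (sin z)"
proof (induction n)
  case 0
  then show ?case by simp
next
  case (Suc n)
  let ?w = "of_nat (2 * n + 2) * z"
  have "of_nat (2 * Suc n + 1) * z = ?w + z" "of_nat (2 * n + 1) * z = ?w - z"
    by (simp_all add: algebra_simps)
  then have eq: "sin (of_nat (2 * Suc n + 1) * z) = sin (of_nat (2 * n + 1) * z) + 2 * cos ?w * sin z"
    by (simp add: sin_add sin_diff)
  have "Im ?w = real (2 * n + 2) * Im z"
    by (simp add: algebra_simps)
  then have "\<bar>Im ?w\<bar> = real (2 * n + 2) * \<bar>Im z\<bar>"
    by (simp only: abs_mult abs_of_nat)
  then have Im: "\<bar>Im ?w\<bar> \<le> t * real (Suc n)"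
    using mult_left_mono[OF z, of "real (2 * n + 2)"] by (simp add: algebra_simps)
  have "norm (cos ?w) \<le> (norm (exp (\<i> * ?w)) + norm (exp (- (\<i> * ?w)))) / 2"
    unfolding cos_exp_eq
    by (simp add: norm_divide norm_triangle_ineq divide_right_mono del: norm_exp_eq_Re)
  also have "\<dots> = (exp (- Im ?w) + exp (Im ?w)) / 2"
    by simp
  also have "\<dots> \<le> exp (t * real (Suc n))"
  proof -
    have "(exp (- x) + exp x) / 2 \<le> exp y" if "\<bar>x\<bar> \<le> y" for x y :: real
    proof -
      have "exp (- x) + exp x \<le> exp y + exp y"
        using that by (intro add_mono) simp_all
      then show ?thesis by simp
    qed
    from this[OF Im] show ?thesis .
  qed
  also have "\<dots> = exp t ^ Suc n"
    by (simp only: exp_of_nat2_mult)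
  finally have cos: "norm (cos ?w) \<le> exp t ^ Suc n" .
  have "norm (sin (of_nat (2 * Suc n + 1) * z))
      \<le> norm (sin (of_nat (2 * n + 1) * z)) + 2 * norm (cos ?w) * norm (sin z)"
    unfolding eq by (rule order_trans[OF norm_triangle_ineq]) (simp add: norm_mult)
  also have "\<dots> \<le> 8 / 3 * exp t ^ n * norm (sin z) + 2 * exp t ^ Suc n * norm (sin z)"
    using Suc.IH cos by (intro add_mono mult_right_mono) auto
  also have "\<dots> = (8 / 3 + 2 * exp t) * (exp t ^ n * norm (sin z))"
    by (simp add: algebra_simps)
  \<comment> \<open>The constant 8/3 closes the induction: 8/3 + 2 e^t <= (8/3) e^t says exactly
    that e^t >= 4.\<close>
  also have "\<dots> \<le> (8 / 3 * exp t) * (exp t ^ n * norm (sin z))"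
    using t by (intro mult_right_mono) auto
  finally show ?case by (simp add: mult_ac)
qed

lemma theta1_strip_nonzero:
  assumes t: "exp t \<ge> 4" and z: "\<bar>Im z\<bar> \<le> t / 2" and sin: "sin z \<noteq> 0"
  shows "theta1 z (exp (- t)) \<noteq> 0"
proof
  define q where "q = exp (- t)"
  define a where "a n = (-1) ^ n * complex_of_real (q powr ((real n + 1/2)\<^sup>2))
                          * sin (of_nat (2 * n + 1) * z)" for n
  define C where "C = q powr (1/4)"
  have "exp t > 1" using t by linarith
  then have "t > 0" by simp
  have q: "0 < q" "q \<le> 1 / 4" "q * exp t = 1"
    using t by (simp_all add: q_def exp_minus field_simps)
  have C: "C > 0" using q by (simp add: C_def)
  have summ: "summable a"
    unfolding a_def q_def by (rule summable_theta1[OF \<open>t > 0\<close>])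
  have a0: "norm (a 0) = C * norm (sin z)"
    using q by (simp add: a_def C_def norm_mult power2_eq_square)
  \<comment> \<open>With m = n + 1, the coefficient is q^(m^2) q^m C. The factor q^m cancels the
    growth e^(tm) of the sine, and q^(m^2) <= q^m leaves a geometric majorant.\<close>
  have le: "norm (a (Suc n)) \<le> 8 / 3 * C * norm (sin z) * q * q ^ n" for n
  proof -
    let ?m = "Suc n"
    have "(real ?m + 1/2)\<^sup>2 = real (?m * ?m) + real ?m + 1/4"
      by (simp add: power2_eq_square field_simps)
    then have "q powr ((real ?m + 1/2)\<^sup>2) = q ^ (?m * ?m) * q ^ ?m * C"
      using q unfolding C_def by (simp only: powr_add powr_realpow)
    then have "norm (a ?m) = q ^ (?m * ?m) * q ^ ?m * C * norm (sin (of_nat (2 * ?m + 1) * z))"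
      using q C unfolding a_def by (simp add: norm_mult norm_power)
    also have "\<dots> \<le> q ^ (?m * ?m) * q ^ ?m * C * (8 / 3 * exp t ^ ?m * norm (sin z))"
      using q C by (intro mult_left_mono norm_sin_odd_mult_le t z) auto
    also have "\<dots> = 8 / 3 * C * norm (sin z) * ((q * exp t) ^ ?m * q ^ (?m * ?m))"
      by (simp only: power_mult_distrib mult_ac)
    also have "\<dots> \<le> 8 / 3 * C * norm (sin z) * q ^ ?m"
      using q C power_decreasing[of ?m "?m * ?m" q] by (intro mult_left_mono) auto
    finally show ?thesis by (simp add: mult_ac)
  qed
  have geo: "(\<lambda>n. 8 / 3 * C * norm (sin z) * q * q ^ n) sums (8 / 3 * C * norm (sin z) * q * (1 / (1 - q)))"
    using q by (intro sums_mult geometric_sums) auto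
  assume "theta1 z (exp (- t)) = 0"
  then have "suminf a = 0"
    unfolding theta1_def q_def[symmetric] a_def[symmetric] by simp
  then have "a 0 = - (\<Sum>n. a (Suc n))"
    using suminf_split_head[OF summ] by simp
  then have "C * norm (sin z) = norm (\<Sum>n. a (Suc n))"
    using a0 by simp
  also have "\<dots> \<le> 8 / 3 * C * norm (sin z) * q * (1 / (1 - q))"
    unfolding sums_unique[OF geo] by (rule norm_suminf_le[OF le sums_summable[OF geo]])
  also have "\<dots> = C * norm (sin z) * (8 / 3 * q / (1 - q))"
    by simp
  \<comment> \<open>For q <= 1/4 the factor (8/3) q/(1-q) is at most 8/9, so the tail cannot cancel
    the leading term.\<close>
  also have "\<dots> < C * norm (sin z) * 1"
    using q C sin by (intro mult_strict_left_mono) (auto simp: field_simps)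
  finally show False by simp
qed

section \<open>From the strip to the zero lattice\<close>

lemma theta1_add_int_tau_eq_0_iff:
  assumes "t > 0"
  shows "theta1 (z + of_int n * (\<i> * of_real t)) (exp (- t)) = 0 \<longleftrightarrow> theta1 z (exp (- t)) = 0"
proof (induction n rule: int_induct[where k = 0])
  case base
  then show ?case by simp
next
  case (step1 n)
  then show ?case
    using theta1_add_period_tau[OF assms, of "z + of_int n * (\<i> * of_real t)"]
    by (simp add: algebra_simps)
next
  case (step2 n)
  then show ?case
    using theta1_add_period_tau[OF assms, of "z + of_int (n - 1) * (\<i> * of_real t)"]
    by (simp add: algebra_simps)
qed

lemma theta1_eq_0D:
  assumes t: "exp t \<ge> 4" and zero: "theta1 z (exp (- t)) = 0"
  obtains m n :: int where "z = of_int m * of_real pi + of_int n * (\<i> * of_real t)"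
proof -
  have "exp t > 1" using t by linarith
  then have "t > 0" by simp
  \<comment> \<open>Subtracting the nearest multiple of i t from z brings the imaginary part into
    [-t/2, t/2].\<close>
  define n where "n = round (Im z / t)"
  define w where "w = z + of_int (- n) * (\<i> * of_real t)"
  have "\<bar>Im z / t - of_int n\<bar> \<le> 1 / 2"
    unfolding n_def using of_int_round_abs_le[of "Im z / t"] by (simp add: abs_minus_commute)
  moreover have "Im w = t * (Im z / t - of_int n)"
    using \<open>t > 0\<close> by (simp add: w_def field_simps)
  ultimately have "\<bar>Im w\<bar> \<le> t / 2"
    using \<open>t > 0\<close> mult_left_mono[of "\<bar>Im z / t - of_int n\<bar>" "1 / 2" t] by (simp add: abs_mult)
  moreover have "theta1 w (exp (- t)) = 0"
    unfolding w_def using zero theta1_add_int_tau_eq_0_iff[OF \<open>t > 0\<close>] by blast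
  ultimately have "sin w = 0"
    using theta1_strip_nonzero[OF t] by blast
  then obtain m :: int where "w = of_int m * of_real pi"
    unfolding sin_eq_0 by auto
  then have "z = of_int m * of_real pi + of_int n * (\<i> * of_real t)"
    by (simp add: w_def algebra_simps)
  then show thesis by (rule that)
qed

lemma theta1_eq_0_imp_torus_lattice:
  assumes "theta1 (z / 2) (exp (- (pi / 2))) = 0"
  shows "z \<in> torus_lattice"
proof -
  \<comment> \<open>Verifies e^(pi/2) >= 4: the quadratic Taylor bound gives e^(3/4) >= 2, hence
    e^(3/2) >= 4, and pi > 3.\<close>
  have "2 \<le> 1 + 3 / 4 + (3 / 4)\<^sup>2 / (2 :: real)"
    by (simp add: power2_eq_square)
  also have "\<dots> \<le> exp (3 / 4)"
    by (rule exp_lower_Taylor_quadratic) simp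
  finally have "4 \<le> exp (3 / 4 :: real) * exp (3 / 4)"
    using mult_mono[of 2 "exp (3 / 4 :: real)" 2 "exp (3 / 4)"] by simp
  also have "\<dots> \<le> exp (pi / 2)"
    using pi_gt3 by (simp flip: exp_add)
  finally obtain m n :: int where "z / 2 = of_int m * of_real pi + of_int n * (\<i> * of_real (pi / 2))"
    using theta1_eq_0D[OF _ assms] by blast
  then have "z = 2 * of_real pi * of_int m + \<i> * of_real pi * of_int n"
    by (simp add: field_simps)
  then show ?thesis
    unfolding torus_lattice_def by blast
qed

lemma theta2_eq_0_imp_torus_lattice:
  assumes "theta2 (z / 2) (exp (- (pi / 2))) = 0"
  shows "z \<in> (\<lambda>w. of_real pi + w) ` torus_lattice"
proof -
  have "theta1 ((z - of_real pi) / 2) (exp (- (pi / 2))) = 0"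
    using theta2_plus_pi_half[of "pi / 2" "(z - of_real pi) / 2"] assms
    by (simp flip: add_divide_distrib)
  then have "z - of_real pi \<in> torus_lattice"
    by (rule theta1_eq_0_imp_torus_lattice)
  then show ?thesis
    by (rule rev_image_eqI) simp
qed

section \<open>The Hamiltonian\<close>

text \<open>The quasi-period factor e^(pi/2 - 2iz) has modulus e^(pi/2 + 2 Im z). Taking the
  logarithm of the product requires a nonzero theta value.\<close>

lemma ln_norm_theta1_add_period_tau:
  assumes "theta1 z (exp (- (pi / 2))) \<noteq> 0"
  shows "ln (norm (theta1 (z + \<i> * of_real (pi / 2)) (exp (- (pi / 2)))))
    = pi / 2 + 2 * Im z + ln (norm (theta1 z (exp (- (pi / 2)))))"
  using assms theta1_add_period_tau[of "pi / 2" z] by (simp add: norm_mult ln_mult)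

lemma ln_norm_theta2_add_period_tau:
  assumes "theta2 z (exp (- (pi / 2))) \<noteq> 0"
  shows "ln (norm (theta2 (z + \<i> * of_real (pi / 2)) (exp (- (pi / 2)))))
    = pi / 2 + 2 * Im z + ln (norm (theta2 z (exp (- (pi / 2)))))"
  using assms ln_norm_theta1_add_period_tau[of "z + of_real pi / 2"]
  unfolding add.assoc add.commute[of "of_real pi / 2"]
  by (simp add: theta1_plus_pi_half flip: add.assoc)

text \<open>Each of these rules changes the theta value at most by a sign, by conjugation or by
  exchanging \<open>theta1\<close> and \<open>theta2\<close>, so moduli can be rewritten with them
  directly.\<close>

lemmas theta_symmetries =
  theta1_minus[OF pi_half_gt_zero] theta2_minus
  theta1_cnj[OF pi_half_gt_zero] theta2_cnj[OF pi_half_gt_zero]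
  theta1_plus_pi_half theta2_plus_pi_half[OF pi_half_gt_zero]
  theta1_plus_pi[OF pi_half_gt_zero] theta2_plus_pi[OF pi_half_gt_zero]

text \<open>The coefficient of \<Gamma>_a \<Gamma>_b in the Hamiltonian. Writing the nome as
  \<open>exp (- (pi / 2))\<close> makes it an instance of \<open>exp (- t)\<close> in the theta
  lemmas.\<close>

definition pair_energy :: "complex \<Rightarrow> complex \<Rightarrow> real" where
  "pair_energy z w =
     ln (norm (theta2 ((z - cnj w) / 2) (exp (- (pi / 2))))) / (2 * pi)
     - ln (norm (theta1 ((z - w) / 2) (exp (- (pi / 2))))) / (2 * pi)
     - Im z * Im w / pi\<^sup>2"

definition self_energy :: "complex \<Rightarrow> real" where
  "self_energy z =
     (ln (norm (theta1 (\<i> * of_real (Im z) - of_real pi / 2) (exp (- (pi / 2)))))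
      - 2 * (Im z)\<^sup>2 / pi) / (4 * pi)"

lemma klein_hamiltonian_eq:
  "klein_hamiltonian N \<Gamma> z =
     (\<Sum>a = 1..N. \<Sum>b\<in>{a<..N}. \<Gamma> a * \<Gamma> b * pair_energy (z a) (z b))
     + (\<Sum>a = 1..N. (\<Gamma> a)\<^sup>2 * self_energy (z a))"
  unfolding klein_hamiltonian_def sum_distrib_left
    sum.distrib[symmetric] sum_subtractf[symmetric]
  by (intro sum.cong arg_cong2[where f = "(+)"] refl)
     (simp_all add: pair_energy_def self_energy_def algebra_simps diff_divide_distrib)

text \<open>Exchanging the vortices negates the argument of \<open>theta1\<close> and turns that of
  \<open>theta2\<close> into minus its conjugate; neither affects the modulus. This serves the pairs
  a < b in which the moved vortex comes second.\<close>

lemma pair_energy_commute: "pair_energy z w = pair_energy w z"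
proof -
  have "(w - z) / 2 = - ((z - w) / 2)" "(w - cnj z) / 2 = - cnj ((z - cnj w) / 2)"
    by (simp_all add: diff_divide_distrib)
  then show ?thesis
    unfolding pair_energy_def
    by (simp only: theta_symmetries norm_minus_cancel complex_mod_cnj mult.commute)
qed

text \<open>Only terms involving vortex \<open>j\<close> can change. Admitting a new strength
  \<open>g\<close> treats the translations and the sign change under the involution alike.\<close>

lemma klein_hamiltonian_fun_upd:
  assumes pair: "\<And>b. b \<in> {1..N} \<Longrightarrow> b \<noteq> j \<Longrightarrow> g * pair_energy w (z b) = \<Gamma> j * pair_energy (z j) (z b)"
    and self: "g\<^sup>2 * self_energy w = (\<Gamma> j)\<^sup>2 * self_energy (z j)"
  shows "klein_hamiltonian N (\<Gamma>(j := g)) (z(j := w)) = klein_hamiltonian N \<Gamma> z"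
proof -
  let ?\<Gamma> = "\<Gamma>(j := g)" and ?z = "z(j := w)"
  have "?\<Gamma> a * ?\<Gamma> b * pair_energy (?z a) (?z b) = \<Gamma> a * \<Gamma> b * pair_energy (z a) (z b)"
    if "a \<in> {1..N}" "b \<in> {a<..N}" for a b
  proof -
    have "a \<noteq> b"
      using that by simp
    then consider "a = j" "b \<noteq> j" | "b = j" "a \<noteq> j" | "a \<noteq> j" "b \<noteq> j"
      by blast
    then show ?thesis
    proof cases
      case 1
      then show ?thesis using pair[of b] that by (simp add: mult_ac)
    next
      case 2
      then show ?thesis
        using pair[of a] that pair_energy_commute[of "z a"] by (simp add: mult_ac)
    qed simp
  qed
  moreover have "(?\<Gamma> a)\<^sup>2 * self_energy (?z a) = (\<Gamma> a)\<^sup>2 * self_energy (z a)" for a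
    using self by simp
  ultimately show ?thesis
    unfolding klein_hamiltonian_eq by (intro arg_cong2[where f = "(+)"] sum.cong refl) auto
qed

section \<open>Energies under the translations and the involution\<close>

lemma pair_energy_add_i_pi:
  assumes "z - w \<notin> torus_lattice" and "z - cnj w \<notin> (\<lambda>u. of_real pi + u) ` torus_lattice"
  shows "pair_energy (z + \<i> * of_real pi) w = pair_energy z w"
proof -
  have shift: "(z + \<i> * of_real pi - u) / 2 = (z - u) / 2 + \<i> * of_real (pi / 2)" for u
    by (simp add: field_simps)
  have nz: "theta1 ((z - w) / 2) (exp (- (pi / 2))) \<noteq> 0"
    "theta2 ((z - cnj w) / 2) (exp (- (pi / 2))) \<noteq> 0"
    using assms theta1_eq_0_imp_torus_lattice theta2_eq_0_imp_torus_lattice by blast+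
  \<comment> \<open>The logarithms grow by pi/2 + Im z + Im w for \<open>theta2\<close> and by pi/2
    + Im z - Im w for \<open>theta1\<close>. Their difference over 2 pi is Im w / pi, which the term
    -Im z Im w / pi^2 compensates.\<close>
  show ?thesis
    unfolding pair_energy_def shift
      ln_norm_theta1_add_period_tau[OF nz(1)] ln_norm_theta2_add_period_tau[OF nz(2)]
    by (simp add: field_simps power2_eq_square)
qed

lemma self_energy_add_i_pi: "self_energy (z + \<i> * of_real pi) = self_energy z"
proof -
  let ?u = "\<i> * of_real (Im z) - of_real pi / 2"
  \<comment> \<open>Here 2v has real part -pi, an odd multiple of pi, whereas real parts of lattice
    points are even multiples.\<close>
  have not_lattice: "2 * v \<notin> torus_lattice" if "Re v = - (pi / 2)" for v
  proof
    assume "2 * v \<in> torus_lattice"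
    then obtain m n :: int
      where "2 * v = 2 * of_real pi * of_int m + \<i> * of_real pi * of_int n"
      unfolding torus_lattice_def by blast
    from arg_cong[OF this, of Re] have "pi * (2 * of_int m + 1) = 0"
      using that by (simp add: algebra_simps)
    then have "real_of_int (2 * m + 1) = 0"
      by simp
    then have "2 * m + 1 = 0"
      by (simp only: of_int_eq_0_iff)
    then show False by presburger
  qed
  have nz: "theta1 v (exp (- (pi / 2))) \<noteq> 0" if "Re v = - (pi / 2)" for v
    using theta1_eq_0_imp_torus_lattice[of "2 * v"] not_lattice[OF that] by auto
  have shift: "\<i> * of_real (Im (z + \<i> * of_real pi)) - of_real pi / 2
      = (?u + \<i> * of_real (pi / 2)) + \<i> * of_real (pi / 2)"
    by (simp add: algebra_simps)
  have nz': "theta1 ?u (exp (- (pi / 2))) \<noteq> 0"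
      "theta1 (?u + \<i> * of_real (pi / 2)) (exp (- (pi / 2))) \<noteq> 0"
    by (intro nz; simp)+
  \<comment> \<open>The argument is not halved here, so i pi is two quasi-periods. With y = Im z
    they add (pi/2 + 2y) + (3 pi/2 + 2y) = 2 pi + 4y, which is also the growth of 2 y^2 /
    pi.\<close>
  show ?thesis
    unfolding self_energy_def shift
      ln_norm_theta1_add_period_tau[OF nz'(2)] ln_norm_theta1_add_period_tau[OF nz'(1)]
    by (simp add: field_simps power2_eq_square)
qed

lemma pair_energy_add_2_pi: "pair_energy (z + 2 * of_real pi) w = pair_energy z w"
proof -
  have shift: "(z + 2 * of_real pi - u) / 2 = (z - u) / 2 + of_real pi" for u
    by (simp add: field_simps)
  show ?thesis
    unfolding pair_energy_def shift theta_symmetries by simp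
qed

text \<open>After halving, the translation in the involution is a shift by pi/2, which exchanges the
  two theta functions and hence the two logarithms. Conjugation reverses the sign of the product of
  heights.\<close>

lemma pair_energy_klein_mu: "pair_energy (klein_mu z) w = - pair_energy z w"
proof -
  have eq: "(klein_mu z - cnj w) / 2 = cnj ((z - w) / 2) + of_real pi / 2"
    "(klein_mu z - w) / 2 = cnj ((z - cnj w) / 2) + of_real pi / 2"
    by (simp_all add: klein_mu_def field_simps)
  show ?thesis
    unfolding pair_energy_def eq theta_symmetries by (simp add: klein_mu_def)
qed

text \<open>The reflected argument is -(u + pi), and \<open>theta1\<close> is odd and changes sign
  under a shift by pi.\<close>

lemma self_energy_klein_mu: "self_energy (klein_mu z) = self_energy z"
proof -
  let ?u = "\<i> * of_real (Im z) - of_real pi / 2"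
  have eq: "\<i> * of_real (Im (klein_mu z)) - of_real pi / 2 = - (?u + of_real pi)"
    by (simp add: klein_mu_def field_simps)
  show ?thesis
    unfolding self_energy_def eq theta_symmetries by (simp add: klein_mu_def)
qed

theorem lemma2p6:
  fixes N j :: nat and \<Gamma> :: "nat \<Rightarrow> real" and z :: "nat \<Rightarrow> complex"
  assumes "N \<ge> 1"
    and "vortex_config N z"
    and "j \<in> {1..N}"
  shows "klein_hamiltonian N \<Gamma> (z(j := z j + \<i> * of_real pi)) = klein_hamiltonian N \<Gamma> z
    \<and> klein_hamiltonian N \<Gamma> (z(j := z j + 2 * of_real pi)) = klein_hamiltonian N \<Gamma> z
    \<and> klein_hamiltonian N (\<Gamma>(j := - \<Gamma> j)) (z(j := klein_mu (z j))) = klein_hamiltonian N \<Gamma> z"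
proof (intro conjI)
  \<comment> \<open>Taking \<open>g\<close> to be the old strength makes the update of \<Gamma>
    trivial, which is the form used for both translations.\<close>
  note upd = klein_hamiltonian_fun_upd[where g = "\<Gamma> j" and \<Gamma> = \<Gamma> and j = j, unfolded fun_upd_triv]
  show "klein_hamiltonian N \<Gamma> (z(j := z j + \<i> * of_real pi)) = klein_hamiltonian N \<Gamma> z"
  proof (rule upd)
    fix b assume "b \<in> {1..N}" "b \<noteq> j"
    then have "z j - z b \<notin> torus_lattice" "z j - cnj (z b) \<notin> (\<lambda>w. of_real pi + w) ` torus_lattice"
      using assms(2)[unfolded vortex_config_def, rule_format, of j b] assms(3)
      by (simp_all only: simp_thms)
    from pair_energy_add_i_pi[OF this]
    show "\<Gamma> j * pair_energy (z j + \<i> * of_real pi) (z b) = \<Gamma> j * pair_energy (z j) (z b)"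
      by (rule arg_cong)
  qed (simp only: self_energy_add_i_pi)
  show "klein_hamiltonian N \<Gamma> (z(j := z j + 2 * of_real pi)) = klein_hamiltonian N \<Gamma> z"
    by (rule upd) (simp_all add: pair_energy_add_2_pi self_energy_def)
  show "klein_hamiltonian N (\<Gamma>(j := - \<Gamma> j)) (z(j := klein_mu (z j))) = klein_hamiltonian N \<Gamma> z"
    by (rule klein_hamiltonian_fun_upd) (simp_all add: pair_energy_klein_mu self_energy_klein_mu)
qed

end
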